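(* Let $M\subset\mathbb{R}^3$ be an orientable surface without umbilic points, parametrized by $X:U\subseteq\mathbb{R}^2\to M$, and let $\widetilde M$, parametrized by $$\widetilde X=X-\frac{2\Omega}{S}\Big(\sum_{i=1}^2\Omega_i e_i-WN\Big),\qquad S=\Omega_1^2+\Omega_2^2+W^2,$$ be associated to $M$ by a Ribaucour transformation with data $(\Omega,\Omega_1,\Omega_2,W)$, so that corresponding normal lines intersect at distance $h=\Omega/W$. Assume that $h$ is not constant along the lines of curvature and that the functions $\Omega,\Omega_i,W$ satisfy one of the two additional relations $$T_1+T_2=\frac{2S}{\Omega}\qquad\text{or}\qquad T_1-T_2=0 ,$$ where $$T_i=2\Big(d\Omega_i(e_i)+\sum_{k}\Omega_k\,w_{ki}(e_i)-W\lambda_i\Big),\quad i=1,2.$$ Then $\widetilde M$, parametrized by $\widetilde X$, is an isothermic surface if and only if $M$ is an isothermic surface.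
   Context: Let $N$ be the unit normal of $M$, $e_1,e_2$ orthonormal principal directions, $\lambda_i$ defined by $dN(e_i)=\lambda_i e_i$ (so $-\lambda_i$ are the principal curvatures), $w_1,w_2$ the dual coframe, and $w_{ij}$ the connection forms, $w_{ij}(Y)=\langle\nabla_Y e_i,e_j\rangle$. Ribaucour transformation: $\widetilde M$ is associated to $M$ if there are a function $h$ on $M$ and a diffeomorphism $\psi:M\to\widetilde M$ such that $p+h(p)N(p)=\psi(p)+h(p)\widetilde N(\psi(p))$ for all $p\in M$ ($\widetilde N$ the Gauss map of $\widetilde M$), the set of points $p+h(p)N(p)$ is a two-dimensional submanifold, and $\psi$ preserves lines of curvature. Such transformations are described locally by data: differentiable functions $\Omega,\Omega_1,\Omega_2,W$ with $W(W+\lambda_i\Omega)\ne 0$, $h=\Omega/W$ (with $\Omega\neq 0$), satisfying $$d\Omega_i(e_j)=\Omega_j w_{ij}(e_j)\ (i\neq j),\qquad d\Omega=\sum_i\Omega_i w_i,\qquad dW=-\sum_i\Omega_i\lambda_i w_i ,$$ and then $\widetilde M$ is parametrized by $\widetilde X$ as in the claim. It is a regular surface where $S-\Omega T_i\neq0$, and its lines of curvature are those corresponding to the lines of curvature of $M$. A surface is isothermic if locally it admits coordinates $(u_1,u_2)$ by lines of curvature that are conformal, i.e. its first fundamental form is $g_{11}du_1^2+g_{22}du_2^2$ with $g_{11}=g_{22}$. For $\widetilde M$ the lines of curvature are understood as those corresponding to the lines of curvature of $M$. *)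

theory Defs
  imports "HOL-Analysis.Analysis"
begin

text \<open>
  Surfaces are given by immersions \<open>X\<close> of an open set \<open>U\<close> of the plane into space.  Functions and
  vector fields on the surface are written as functions of the parameter \<open>u \<in> U\<close>; a tangent vector
  of the surface at \<open>X u\<close> is represented by the parameter vector \<open>v\<close> that the differential of \<open>X\<close>
  maps to it.  A map between two surfaces parametrized over the same \<open>U\<close> takes \<open>X u\<close> to \<open>Xt u\<close>, so
  in parameters it is the identity.
\<close>

abbreviation dif :: "('a::real_normed_vector \<Rightarrow> 'b::real_normed_vector) \<Rightarrow> 'a \<Rightarrow> 'a \<Rightarrow> 'b" where
  "dif f u v \<equiv> frechet_derivative f (at u) v"

text \<open>\<open>Ck_on\<close> and \<open>smooth_on\<close> use full derivatives and are meant for open \<open>U\<close> only.\<close>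

primrec Ck_on :: "nat \<Rightarrow> ('a::real_normed_vector \<Rightarrow> 'b::real_normed_vector) \<Rightarrow> 'a set \<Rightarrow> bool" where
  "Ck_on 0 f U \<longleftrightarrow> continuous_on U f"
| "Ck_on (Suc k) f U \<longleftrightarrow>
     (\<forall>u\<in>U. f differentiable (at u)) \<and> (\<forall>v. Ck_on k (\<lambda>u. dif f u v) U)"

definition smooth_on :: "('a::real_normed_vector \<Rightarrow> 'b::real_normed_vector) \<Rightarrow> 'a set \<Rightarrow> bool" where
  "smooth_on f U \<longleftrightarrow> (\<forall>k. Ck_on k f U)"

definition diffeo_between :: "(real^2 \<Rightarrow> real^2) \<Rightarrow> (real^2) set \<Rightarrow> (real^2) set \<Rightarrow> bool" where
  "diffeo_between \<phi> D V \<longleftrightarrow>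
     open D \<and> open V \<and> smooth_on \<phi> D \<and> (\<exists>\<psi>. smooth_on \<psi> V \<and> homeomorphism D V \<phi> \<psi>)"

definition surface :: "(real^2 \<Rightarrow> real^3) \<Rightarrow> (real^2) set \<Rightarrow> bool" where
  "surface X U \<longleftrightarrow> open U \<and> smooth_on X U \<and> (\<forall>u\<in>U. inj (dif X u))"

definition unit_normal :: "(real^2 \<Rightarrow> real^3) \<Rightarrow> (real^2) set \<Rightarrow> (real^2 \<Rightarrow> real^3) \<Rightarrow> bool" where
  "unit_normal X U N \<longleftrightarrow>
     smooth_on N U \<and> (\<forall>u\<in>U. norm (N u) = 1 \<and> (\<forall>v. dif X u v \<bullet> N u = 0))"

definition umbilic :: "(real^2 \<Rightarrow> real^3) \<Rightarrow> (real^2 \<Rightarrow> real^3) \<Rightarrow> real^2 \<Rightarrow> bool" where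
  "umbilic X N u \<longleftrightarrow> (\<exists>c. \<forall>v. dif N u v = c *\<^sub>R dif X u v)"

definition principal_dir :: "(real^2 \<Rightarrow> real^3) \<Rightarrow> (real^2 \<Rightarrow> real^3) \<Rightarrow> real^2 \<Rightarrow> real^2 \<Rightarrow> bool" where
  "principal_dir X N u v \<longleftrightarrow> v \<noteq> 0 \<and> (\<exists>c. dif N u v = c *\<^sub>R dif X u v)"

definition line_of_curvature ::
  "(real^2 \<Rightarrow> real^3) \<Rightarrow> (real^2 \<Rightarrow> real^3) \<Rightarrow> (real^2) set \<Rightarrow> real set \<Rightarrow> (real \<Rightarrow> real^2) \<Rightarrow> bool" where
  "line_of_curvature X N U I c \<longleftrightarrow>
     open I \<and> is_interval I \<and> I \<noteq> {} \<and> smooth_on c I \<and>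
     (\<forall>t\<in>I. c t \<in> U \<and> principal_dir X N (c t) (vector_derivative c (at t)))"

definition frame :: "(real^2 \<Rightarrow> real^3) \<Rightarrow> (2 \<Rightarrow> real^2 \<Rightarrow> real^2) \<Rightarrow> 2 \<Rightarrow> real^2 \<Rightarrow> real^3" where
  "frame X E i u = dif X u (E i u)"

text \<open>
  \<open>E i\<close> is the parameter representation of the principal direction \<open>e\<^sub>i\<close>, which as a vector in space
  is \<open>frame X E i\<close>.  With this sign convention the principal curvatures are \<open>- lam i\<close>.
\<close>

definition principal_frame ::
  "(real^2 \<Rightarrow> real^3) \<Rightarrow> (real^2) set \<Rightarrow> (real^2 \<Rightarrow> real^3) \<Rightarrow>
   (2 \<Rightarrow> real^2 \<Rightarrow> real^2) \<Rightarrow> (2 \<Rightarrow> real^2 \<Rightarrow> real) \<Rightarrow> bool" where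
  "principal_frame X U N E lam \<longleftrightarrow>
     (\<forall>i. smooth_on (E i) U \<and> smooth_on (lam i) U) \<and>
     (\<forall>u\<in>U. (\<forall>i j. frame X E i u \<bullet> frame X E j u = (if i = j then 1 else 0)) \<and>
             (\<forall>i. dif N u (E i u) = lam i u *\<^sub>R frame X E i u))"

text \<open>For an orthonormal frame this is the dual coframe \<open>w\<^sub>i\<close>.\<close>

definition coframe ::
  "(real^2 \<Rightarrow> real^3) \<Rightarrow> (2 \<Rightarrow> real^2 \<Rightarrow> real^2) \<Rightarrow> 2 \<Rightarrow> real^2 \<Rightarrow> real^2 \<Rightarrow> real" where
  "coframe X E i u v = dif X u v \<bullet> frame X E i u"

text \<open>
  The Levi-Civita connection of the induced metric: the tangential part of the derivative of a
  tangent field \<open>Z\<close>, given as a field of vectors in space.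
\<close>

definition cov_deriv ::
  "(real^2 \<Rightarrow> real^3) \<Rightarrow> (real^2 \<Rightarrow> real^3) \<Rightarrow> real^2 \<Rightarrow> real^2 \<Rightarrow> real^3" where
  "cov_deriv N Z u v = dif Z u v - (dif Z u v \<bullet> N u) *\<^sub>R N u"

definition conn_form ::
  "(real^2 \<Rightarrow> real^3) \<Rightarrow> (real^2 \<Rightarrow> real^3) \<Rightarrow> (2 \<Rightarrow> real^2 \<Rightarrow> real^2) \<Rightarrow>
   2 \<Rightarrow> 2 \<Rightarrow> real^2 \<Rightarrow> real^2 \<Rightarrow> real" where
  "conn_form X N E i j u v = cov_deriv N (frame X E i) u v \<bullet> frame X E j u"

text \<open>
  The Ribaucour correspondence \<open>X u \<mapsto> Xt u\<close>.  The locus of centres is required to be an immersed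
  surface.  Only one direction of the preservation of lines of curvature is asked for, because
  \<open>Xt\<close> may have umbilic points, where every direction is principal.
\<close>

definition ribaucour_associated ::
  "(real^2 \<Rightarrow> real^3) \<Rightarrow> (real^2) set \<Rightarrow> (real^2 \<Rightarrow> real^3) \<Rightarrow> (real^2 \<Rightarrow> real) \<Rightarrow>
   (real^2 \<Rightarrow> real^3) \<Rightarrow> bool" where
  "ribaucour_associated X U N h Xt \<longleftrightarrow>
     smooth_on h U \<and> surface Xt U \<and>
     (\<exists>Nt. unit_normal Xt U Nt \<and>
        (\<forall>u\<in>U. X u + h u *\<^sub>R N u = Xt u + h u *\<^sub>R Nt u) \<and>
        surface (\<lambda>u. X u + h u *\<^sub>R N u) U \<and>
        (\<forall>I c. line_of_curvature X N U I c \<longrightarrow> line_of_curvature Xt Nt U I c))"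

text \<open>\<open>Om\<close>, \<open>Omi 1\<close>, \<open>Omi 2\<close>, \<open>W\<close> are the functions \<open>\<Omega>\<close>, \<open>\<Omega>\<^sub>1\<close>, \<open>\<Omega>\<^sub>2\<close>, \<open>W\<close>.\<close>

definition ribaucour_data ::
  "(real^2 \<Rightarrow> real^3) \<Rightarrow> (real^2) set \<Rightarrow> (real^2 \<Rightarrow> real^3) \<Rightarrow>
   (2 \<Rightarrow> real^2 \<Rightarrow> real^2) \<Rightarrow> (2 \<Rightarrow> real^2 \<Rightarrow> real) \<Rightarrow>
   (real^2 \<Rightarrow> real) \<Rightarrow> (2 \<Rightarrow> real^2 \<Rightarrow> real) \<Rightarrow> (real^2 \<Rightarrow> real) \<Rightarrow> bool" where
  "ribaucour_data X U N E lam Om Omi W \<longleftrightarrow>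
     smooth_on Om U \<and> (\<forall>i. smooth_on (Omi i) U) \<and> smooth_on W U \<and>
     (\<forall>u\<in>U. Om u \<noteq> 0 \<and>
        (\<forall>i. W u * (W u + lam i u * Om u) \<noteq> 0) \<and>
        (\<forall>i j. i \<noteq> j \<longrightarrow> dif (Omi i) u (E j u) = Omi j u * conn_form X N E i j u (E j u)) \<and>
        (\<forall>v. dif Om u v = (\<Sum>i\<in>UNIV. Omi i u * coframe X E i u v)) \<and>
        (\<forall>v. dif W u v = - (\<Sum>i\<in>UNIV. Omi i u * lam i u * coframe X E i u v)))"

definition ribaucour_S ::
  "(2 \<Rightarrow> real^2 \<Rightarrow> real) \<Rightarrow> (real^2 \<Rightarrow> real) \<Rightarrow> real^2 \<Rightarrow> real" where
  "ribaucour_S Omi W u = (Omi 1 u)\<^sup>2 + (Omi 2 u)\<^sup>2 + (W u)\<^sup>2"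

definition ribaucour_T ::
  "(real^2 \<Rightarrow> real^3) \<Rightarrow> (real^2 \<Rightarrow> real^3) \<Rightarrow> (2 \<Rightarrow> real^2 \<Rightarrow> real^2) \<Rightarrow>
   (2 \<Rightarrow> real^2 \<Rightarrow> real) \<Rightarrow> (2 \<Rightarrow> real^2 \<Rightarrow> real) \<Rightarrow> (real^2 \<Rightarrow> real) \<Rightarrow>
   2 \<Rightarrow> real^2 \<Rightarrow> real" where
  "ribaucour_T X N E lam Omi W i u =
     2 * (dif (Omi i) u (E i u) + (\<Sum>k\<in>UNIV. Omi k u * conn_form X N E k i u (E i u))
          - W u * lam i u)"

definition ribaucour_param ::
  "(real^2 \<Rightarrow> real^3) \<Rightarrow> (real^2 \<Rightarrow> real^3) \<Rightarrow> (2 \<Rightarrow> real^2 \<Rightarrow> real^2) \<Rightarrow>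
   (real^2 \<Rightarrow> real) \<Rightarrow> (2 \<Rightarrow> real^2 \<Rightarrow> real) \<Rightarrow> (real^2 \<Rightarrow> real) \<Rightarrow> real^2 \<Rightarrow> real^3" where
  "ribaucour_param X N E Om Omi W u =
     X u - (2 * Om u / ribaucour_S Omi W u) *\<^sub>R
       ((\<Sum>i\<in>UNIV. Omi i u *\<^sub>R frame X E i u) - W u *\<^sub>R N u)"

definition fff :: "(real^2 \<Rightarrow> real^3) \<Rightarrow> 2 \<Rightarrow> 2 \<Rightarrow> real^2 \<Rightarrow> real" where
  "fff Y i j x = dif Y x (axis i 1) \<bullet> dif Y x (axis j 1)"

text \<open>
  The surface \<open>X\<close> is isothermic with respect to the lines of curvature whose tangent directions in
  parameters are given by \<open>P\<close>.  Here \<open>P\<close> is a parameter, rather than \<open>principal_dir X N\<close>, so that on the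
  transformed surface the lines of curvature can be taken to be those corresponding to the lines of
  curvature of the original one.
\<close>

definition isothermic_wrt ::
  "(real^2 \<Rightarrow> real^2 \<Rightarrow> bool) \<Rightarrow> (real^2 \<Rightarrow> real^3) \<Rightarrow> (real^2) set \<Rightarrow> bool" where
  "isothermic_wrt P X U \<longleftrightarrow>
     (\<forall>p\<in>U. \<exists>D V \<phi>. p \<in> V \<and> V \<subseteq> U \<and> diffeo_between \<phi> D V \<and>
        (\<forall>x\<in>D. (\<forall>i. P (\<phi> x) (dif \<phi> x (axis i 1))) \<and>
                fff (X \<circ> \<phi>) 1 2 x = 0 \<and> fff (X \<circ> \<phi>) 1 1 x = fff (X \<circ> \<phi>) 2 2 x))"

end

theory Submission imports Defs
begin

text \<open>
  The transformed surface is conformal to the original one, point by point: in parameters its first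
  fundamental form is a positive multiple of that of \<open>X\<close>.  Both isothermic conditions refer to the
  same parameter directions, so a chart proves the one exactly when it proves the other.

  Put \<open>Z = \<Sum>\<^sub>i \<Omega>\<^sub>i e\<^sub>i - W N\<close>.  Then \<open>S = Z \<bullet> Z\<close>, the formula for the transformed surface is
  \<open>X - (2\<Omega> / (Z \<bullet> Z)) Z\<close>, and \<open>\<Omega>\<^sub>i = Z \<bullet> e\<^sub>i\<close>.  The equations satisfied by the data imply that the
  derivative of \<open>Z\<close> in the direction \<open>e\<^sub>i\<close> is \<open>(T\<^sub>i / 2) e\<^sub>i\<close>, without components along the other
  principal direction and the normal (lemma \<open>ribaucour_vec_derivative\<close>).  Differentiating the formula
  for the transformed surface then shows that its differential maps \<open>e\<^sub>i\<close> to \<open>1 - \<Omega> T\<^sub>i / S\<close> times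
  the mirror image of \<open>e\<^sub>i\<close> in the plane orthogonal to \<open>Z\<close> (lemma \<open>ribaucour_param_derivative\<close>).
  A reflection is an isometry, so the new metric is diagonal in the principal frame, with entries
  \<open>(1 - \<Omega> T\<^sub>i / S)\<^sup>2\<close>.  Each of the two additional relations makes these entries equal: for
  \<open>T\<^sub>1 = T\<^sub>2\<close> the factors agree, and for \<open>T\<^sub>1 + T\<^sub>2 = 2 S / \<Omega>\<close> they are opposite.
  The common value is nonzero because the transformed surface is immersed.
\<close>

section \<open>Differentiability of smooth maps\<close>

lemma smooth_on_imp_differentiable:
  assumes "smooth_on f U" "u \<in> U"
  shows "f differentiable (at u)"
proof -
  have "Ck_on (Suc 0) f U" using assms(1) unfolding smooth_on_def by blast
  then show ?thesis using assms(2) by simp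
qed

lemma smooth_on_dif:
  assumes "smooth_on f U"
  shows "smooth_on (\<lambda>u. dif f u v) U"
  unfolding smooth_on_def
proof
  fix k
  have "Ck_on (Suc k) f U" using assms unfolding smooth_on_def by blast
  then show "Ck_on k (\<lambda>u. dif f u v) U" by simp
qed

lemma dif_has_derivative:
  assumes "smooth_on f U" "u \<in> U"
  shows "(f has_derivative dif f u) (at u)"
  using smooth_on_imp_differentiable[OF assms] by (simp add: frechet_derivative_works)

text \<open>
  Smoothness is given through derivatives in fixed directions, so the field is first expanded in a
  constant basis.
\<close>

lemma dif_along_field_differentiable:
  fixes f :: "'a::euclidean_space \<Rightarrow> 'b::real_normed_vector"
  assumes "open U" "smooth_on f U" "smooth_on V U" "u \<in> U"
  shows "(\<lambda>x. dif f x (V x)) differentiable (at u)"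
proof -
  let ?g = "\<lambda>x. \<Sum>b\<in>Basis. (V x \<bullet> b) *\<^sub>R dif f x b"
  have eq: "?g x = dif f x (V x)" if "x \<in> U" for x
  proof -
    have lin: "linear (dif f x)"
      using dif_has_derivative[OF assms(2) that] has_derivative_linear by blast
    have "dif f x (V x) = dif f x (\<Sum>b\<in>Basis. (V x \<bullet> b) *\<^sub>R b)"
      by (simp add: euclidean_representation)
    also have "\<dots> = ?g x"
      by (simp add: linear_sum[OF lin] linear_cmul[OF lin])
    finally show ?thesis by simp
  qed
  have V: "V differentiable (at u)"
    using smooth_on_imp_differentiable assms(3,4) by blast
  have b: "(\<lambda>x. dif f x b) differentiable (at u)" for b
    using smooth_on_imp_differentiable smooth_on_dif assms(2,4) by blast
  have "?g differentiable (at u)"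
    using V b by (intro differentiable_sum differentiable_scaleR ballI)
      (auto intro!: differentiable_inner)
  then obtain g' where "(?g has_derivative g') (at u)"
    unfolding differentiable_def by blast
  then have "((\<lambda>x. dif f x (V x)) has_derivative g') (at u)"
    by (rule has_derivative_transform_within_open[OF _ assms(1,4) eq])
  then show ?thesis unfolding differentiable_def by blast
qed

lemma dif_inner_of_constant:
  fixes f g :: "'a::real_normed_vector \<Rightarrow> 'b::real_inner"
  assumes "open U" "u \<in> U" "f differentiable (at u)" "g differentiable (at u)"
    and const: "\<And>x. x \<in> U \<Longrightarrow> f x \<bullet> g x = c"
  shows "dif f u v \<bullet> g u + f u \<bullet> dif g u v = 0"
proof -
  have "((\<lambda>x. f x \<bullet> g x) has_derivative (\<lambda>v. f u \<bullet> dif g u v + dif f u v \<bullet> g u)) (at u)"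
    using assms(3,4) by (intro has_derivative_inner) (simp_all add: frechet_derivative_works)
  then have "((\<lambda>x. c) has_derivative (\<lambda>v. f u \<bullet> dif g u v + dif f u v \<bullet> g u)) (at u)"
    by (rule has_derivative_transform_within_open[OF _ assms(1,2) const])
  from has_derivative_unique[OF this has_derivative_const]
  have "f u \<bullet> dif g u v + dif f u v \<bullet> g u = 0" by meson
  then show ?thesis by simp
qed

section \<open>Reflections\<close>

definition mirror :: "'a::real_inner \<Rightarrow> 'a \<Rightarrow> 'a" where
  "mirror z x = x - (2 * (z \<bullet> x) / (z \<bullet> z)) *\<^sub>R z"

lemma mirror_inner:
  assumes "z \<noteq> 0"
  shows "mirror z x \<bullet> mirror z y = x \<bullet> y"
  using assms
  by (simp add: mirror_def inner_diff_left inner_diff_right inner_commute[of x z] field_simps)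

text \<open>
  The map \<open>x \<mapsto> x - (2\<omega> / (Z \<bullet> Z)) Z\<close> moves a point to its mirror image in a plane with normal \<open>Z\<close>.
  If \<open>d\<omega> = Z \<bullet> dX\<close> in a direction \<open>v\<close> in which \<open>dZ\<close> is a multiple of \<open>dX\<close>, the derivative of the image
  is again a mirror image: the terms with \<open>d\<omega>\<close> and \<open>d(Z \<bullet> Z)\<close> are multiples of \<open>(Z \<bullet> dX) Z\<close> and
  combine with \<open>dX\<close> and \<open>dZ\<close> to a reflection with a common factor.
\<close>

lemma derivative_of_mirrored_point:
  fixes X Z :: "'a::real_normed_vector \<Rightarrow> 'b::real_inner"
  assumes X: "(X has_derivative X') (at u)"
    and Z: "(Z has_derivative Z') (at u)"
    and om: "(om has_derivative om') (at u)"
    and nz: "Z u \<noteq> 0"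
    and om_v: "om' v = Z u \<bullet> X' v"
    and Z_v: "Z' v = t *\<^sub>R X' v"
  shows "dif (\<lambda>x. X x - (2 * om x / (Z x \<bullet> Z x)) *\<^sub>R Z x) u v
           = (1 - 2 * om u * t / (Z u \<bullet> Z u)) *\<^sub>R mirror (Z u) (X' v)"
proof -
  let ?S = "Z u \<bullet> Z u" and ?S' = "\<lambda>v. Z u \<bullet> Z' v + Z' v \<bullet> Z u"
  let ?D = "\<lambda>v. X' v - ((2 * om u / ?S) *\<^sub>R Z' v
      + (((2 * om' v) * ?S - (2 * om u) * ?S' v) / (?S * ?S)) *\<^sub>R Z u)"
  have S: "((\<lambda>x. Z x \<bullet> Z x) has_derivative ?S') (at u)"
    using Z Z by (rule has_derivative_inner)
  have "?S \<noteq> 0" using nz by simp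
  then have "((\<lambda>x. X x - (2 * om x / (Z x \<bullet> Z x)) *\<^sub>R Z x) has_derivative ?D) (at u)"
    by (intro has_derivative_diff X has_derivative_scaleR Z has_derivative_divide' S
        has_derivative_mult_right om)
  then have "dif (\<lambda>x. X x - (2 * om x / (Z x \<bullet> Z x)) *\<^sub>R Z x) u = ?D"
    by (rule frechet_derivative_at[symmetric])
  then have eq: "dif (\<lambda>x. X x - (2 * om x / (Z x \<bullet> Z x)) *\<^sub>R Z x) u v = ?D v"
    by simp
  define p where "p = Z u \<bullet> X' v"
  have S'v: "?S' v = 2 * t * p" and om'v: "om' v = p"
    by (simp_all add: Z_v om_v p_def inner_commute)
  have coeff: "((2 * p) * ?S - (2 * om u) * (2 * t * p)) / (?S * ?S)
      = (1 - 2 * om u * t / ?S) * (2 * p / ?S)"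
    using \<open>?S \<noteq> 0\<close> by (simp add: field_simps)
  have "?D v = X' v - ((2 * om u * t / ?S) *\<^sub>R X' v
      + ((1 - 2 * om u * t / ?S) * (2 * p / ?S)) *\<^sub>R Z u)"
    unfolding S'v om'v coeff by (simp add: Z_v)
  also have "\<dots> = (1 - 2 * om u * t / ?S) *\<^sub>R mirror (Z u) (X' v)"
    unfolding mirror_def p_def[symmetric] by (simp only: scaleR_left_diff_distrib
        scaleR_right_diff_distrib scaleR_scaleR scaleR_one diff_diff_eq)
  finally show ?thesis using eq by simp
qed

section \<open>Structure equations of a principal frame\<close>

locale framed_surface =
  fixes X N :: "real^2 \<Rightarrow> real^3" and U :: "(real^2) set"
    and E :: "2 \<Rightarrow> real^2 \<Rightarrow> real^2" and lam :: "2 \<Rightarrow> real^2 \<Rightarrow> real"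
  assumes surf: "surface X U"
    and normal: "unit_normal X U N"
    and princ: "principal_frame X U N E lam"
begin

lemma open_U: "open U" and smooth_X: "smooth_on X U"
  using surf by (simp_all add: surface_def)

lemma smooth_N: "smooth_on N U"
  using normal by (simp add: unit_normal_def)

lemma frame_inner:
  "u \<in> U \<Longrightarrow> frame X E i u \<bullet> frame X E j u = (if i = j then 1 else 0)"
  using princ by (simp add: principal_frame_def)

lemma frame_inner_normal:
  "u \<in> U \<Longrightarrow> frame X E i u \<bullet> N u = 0"
  using normal by (simp add: unit_normal_def frame_def)

lemma normal_inner_frame:
  "u \<in> U \<Longrightarrow> N u \<bullet> frame X E i u = 0"
  using frame_inner_normal by (simp add: inner_commute)

lemma normal_inner_self:
  "u \<in> U \<Longrightarrow> N u \<bullet> N u = 1"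
  using normal by (simp add: unit_normal_def norm_eq_1)

lemma dif_normal_frame:
  "u \<in> U \<Longrightarrow> dif N u (E i u) = lam i u *\<^sub>R frame X E i u"
  using princ by (simp add: principal_frame_def)

lemma frame_differentiable:
  assumes "u \<in> U"
  shows "frame X E i differentiable (at u)"
proof -
  have "smooth_on (E i) U" using princ by (simp add: principal_frame_def)
  then have "(\<lambda>u. dif X u (E i u)) differentiable (at u)"
    by (rule dif_along_field_differentiable[OF open_U smooth_X _ assms])
  moreover have "(\<lambda>u. dif X u (E i u)) = frame X E i" by (simp add: frame_def fun_eq_iff)
  ultimately show ?thesis by simp
qed

lemma frame_expansion:
  assumes u: "u \<in> U"
  shows "(\<Sum>i\<in>UNIV. (x \<bullet> frame X E i u) *\<^sub>R frame X E i u) + (x \<bullet> N u) *\<^sub>R N u = x"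
proof -
  let ?a = "frame X E 1 u" and ?b = "frame X E 2 u" and ?n = "N u"
  note inn = frame_inner[OF u] frame_inner_normal[OF u] normal_inner_frame[OF u]
    normal_inner_self[OF u]
  have ab: "?a \<noteq> ?b" "?a \<noteq> ?n" "?b \<noteq> ?n"
    using inn(1)[of 1 1] inn(1)[of 1 2] inn(1)[of 2 2] inn(2)[of 1] inn(2)[of 2] by auto
  have orth: "pairwise orthogonal {?a, ?b, ?n}"
    by (auto simp: pairwise_def orthogonal_def inn)
  have unit: "norm b = 1" if "b \<in> {?a, ?b, ?n}" for b
    using that inn by (auto simp: norm_eq_1)
  have "independent {?a, ?b, ?n}"
    using orth unit by (intro pairwise_orthogonal_independent) (simp, metis norm_zero zero_neq_one)
  moreover have "card {?a, ?b, ?n} = 3" using ab by simp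
  ultimately have "UNIV \<subseteq> span {?a, ?b, ?n}"
    by (intro card_ge_dim_independent) simp_all
  then have "(\<Sum>b\<in>{?a, ?b, ?n}. (x \<bullet> b) *\<^sub>R b) = x"
    using orth unit by (intro orthonormal_basis_expand) auto
  then show ?thesis using ab by (simp add: sum_2 add.assoc)
qed

lemma tangent_expansion:
  assumes "u \<in> U"
  shows "v = (\<Sum>i\<in>UNIV. coframe X E i u v *\<^sub>R E i u)"
proof -
  have lin: "linear (dif X u)"
    using dif_has_derivative[OF smooth_X assms] has_derivative_linear by blast
  have "dif X u v \<bullet> N u = 0" using normal assms by (simp add: unit_normal_def)
  then have "dif X u v = (\<Sum>i\<in>UNIV. coframe X E i u v *\<^sub>R frame X E i u)"
    using frame_expansion[OF assms, of "dif X u v"] by (simp add: coframe_def)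
  also have "\<dots> = dif X u (\<Sum>i\<in>UNIV. coframe X E i u v *\<^sub>R E i u)"
    by (simp add: linear_sum[OF lin] linear_cmul[OF lin] frame_def)
  finally show ?thesis
    using surf assms by (meson injD surface_def)
qed

lemma coframe_frame:
  "u \<in> U \<Longrightarrow> coframe X E i u (E j u) = (if i = j then 1 else 0)"
  using frame_inner[of u j i] by (auto simp: coframe_def frame_def)

lemma conn_form_eq:
  "u \<in> U \<Longrightarrow> conn_form X N E i j u v = dif (frame X E i) u v \<bullet> frame X E j u"
  by (simp add: conn_form_def cov_deriv_def inner_diff_left normal_inner_frame)

lemma conn_form_skew:
  assumes "u \<in> U"
  shows "conn_form X N E i j u v = - conn_form X N E j i u v"
  using dif_inner_of_constant[OF open_U assms frame_differentiable[OF assms]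
      frame_differentiable[OF assms] frame_inner[where i = i and j = j], where v = v]
  by (simp add: conn_form_eq[OF assms] inner_commute)

text \<open>
  The Gauss formula.  The second fundamental form is diagonal in the frame, so \<open>e\<^sub>k\<close> turns
  towards the normal only in its own direction.
\<close>

lemma dif_frame:
  assumes u: "u \<in> U"
  shows "dif (frame X E k) u (E i u)
    = (\<Sum>j\<in>UNIV. conn_form X N E k j u (E i u) *\<^sub>R frame X E j u)
      - (if k = i then lam i u else 0) *\<^sub>R N u"
proof -
  have "dif (frame X E k) u (E i u) \<bullet> N u + frame X E k u \<bullet> dif N u (E i u) = 0"
    using u by (intro dif_inner_of_constant[OF open_U u _ _ frame_inner_normal]
        frame_differentiable smooth_on_imp_differentiable[OF smooth_N])
  then have "dif (frame X E k) u (E i u) \<bullet> N u = - (if k = i then lam i u else 0)"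
    using u by (simp add: dif_normal_frame frame_inner split: if_splits)
  then show ?thesis
    using frame_expansion[OF u, of "dif (frame X E k) u (E i u)"]
    by (simp add: conn_form_eq[OF u])
qed

end

section \<open>The differential of a Ribaucour transform\<close>

text \<open>Up to the factor \<open>- 2 \<Omega> / S\<close>, this is the displacement from the surface to its transform.\<close>

definition ribaucour_vec ::
  "(real^2 \<Rightarrow> real^3) \<Rightarrow> (real^2 \<Rightarrow> real^3) \<Rightarrow> (2 \<Rightarrow> real^2 \<Rightarrow> real^2) \<Rightarrow>
   (2 \<Rightarrow> real^2 \<Rightarrow> real) \<Rightarrow> (real^2 \<Rightarrow> real) \<Rightarrow> real^2 \<Rightarrow> real^3" where
  "ribaucour_vec X N E Omi W u = (\<Sum>i\<in>UNIV. Omi i u *\<^sub>R frame X E i u) - W u *\<^sub>R N u"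

locale ribaucour_surface = framed_surface +
  fixes Om W :: "real^2 \<Rightarrow> real" and Omi :: "2 \<Rightarrow> real^2 \<Rightarrow> real"
  assumes data: "ribaucour_data X U N E lam Om Omi W"
begin

abbreviation "S \<equiv> ribaucour_S Omi W"
abbreviation "T \<equiv> ribaucour_T X N E lam Omi W"
abbreviation "Z \<equiv> ribaucour_vec X N E Omi W"

lemma dif_Omi:
  "u \<in> U \<Longrightarrow> i \<noteq> j \<Longrightarrow> dif (Omi i) u (E j u) = Omi j u * conn_form X N E i j u (E j u)"
  using data by (simp add: ribaucour_data_def)

lemma dif_Om: "u \<in> U \<Longrightarrow> dif Om u (E i u) = Omi i u"
  using data exhaust_2[of i] by (auto simp: ribaucour_data_def coframe_frame sum_2)

lemma dif_W: "u \<in> U \<Longrightarrow> dif W u (E i u) = - (Omi i u * lam i u)"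
  using data exhaust_2[of i] by (auto simp: ribaucour_data_def coframe_frame sum_2)

lemma ribaucour_vec_inner_frame:
  "u \<in> U \<Longrightarrow> Z u \<bullet> frame X E i u = Omi i u"
  using exhaust_2[of i]
  by (auto simp: ribaucour_vec_def sum_2 inner_diff_left inner_add_left frame_inner
      normal_inner_frame)

lemma ribaucour_vec_inner_self:
  assumes u: "u \<in> U"
  shows "Z u \<bullet> Z u = S u"
proof -
  have "Z u \<bullet> Z u = (\<Sum>i\<in>UNIV. Omi i u * (Z u \<bullet> frame X E i u)) - W u * (Z u \<bullet> N u)"
    by (subst (2) ribaucour_vec_def) (simp add: inner_diff_right inner_sum_right)
  moreover have "Z u \<bullet> N u = - W u"
    using u by (simp add: ribaucour_vec_def sum_2 inner_diff_left inner_add_left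
        frame_inner_normal normal_inner_self)
  ultimately show ?thesis
    using u by (simp add: ribaucour_vec_inner_frame ribaucour_S_def sum_2 power2_eq_square)
qed

lemma ribaucour_S_pos:
  assumes "u \<in> U"
  shows "S u > 0"
proof -
  have "W u \<noteq> 0" using data assms by (auto simp: ribaucour_data_def)
  then have "0 < (W u)\<^sup>2" by simp
  then show ?thesis unfolding ribaucour_S_def by (simp add: add_nonneg_pos)
qed

lemma ribaucour_vec_has_derivative:
  assumes "u \<in> U"
  shows "(Z has_derivative
    (\<lambda>v. (\<Sum>k\<in>UNIV. Omi k u *\<^sub>R dif (frame X E k) u v + dif (Omi k) u v *\<^sub>R frame X E k u)
         - (W u *\<^sub>R dif N u v + dif W u v *\<^sub>R N u))) (at u)"
proof -
  have "(Omi k has_derivative dif (Omi k) u) (at u)" for k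
    using data assms by (intro dif_has_derivative) (auto simp: ribaucour_data_def)
  moreover have "(W has_derivative dif W u) (at u)"
    using data assms by (intro dif_has_derivative) (auto simp: ribaucour_data_def)
  moreover have "(frame X E k has_derivative dif (frame X E k) u) (at u)" for k
    using frame_differentiable[OF assms] by (simp add: frechet_derivative_works)
  moreover have "(N has_derivative dif N u) (at u)"
    using dif_has_derivative smooth_N assms by blast
  ultimately show ?thesis
    unfolding ribaucour_vec_def[abs_def]
    by (intro has_derivative_diff has_derivative_sum has_derivative_scaleR)
qed

text \<open>
  The normal component vanishes because \<open>dW\<close> is prescribed through the second fundamental form, and
  the component along the other principal direction because the equation for \<open>d\<Omega>\<^sub>j(e\<^sub>i)\<close> cancels the
  rotation of \<open>e\<^sub>i\<close>, the connection forms being skew.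
\<close>

lemma ribaucour_vec_derivative:
  assumes u: "u \<in> U"
  shows "dif Z u (E i u) = (T i u / 2) *\<^sub>R frame X E i u"
proof -
  have "dif Z u (E i u)
      = (\<Sum>k\<in>UNIV. Omi k u *\<^sub>R dif (frame X E k) u (E i u)
                    + dif (Omi k) u (E i u) *\<^sub>R frame X E k u)
        - (W u *\<^sub>R dif N u (E i u) + dif W u (E i u) *\<^sub>R N u)"
    using frechet_derivative_at[OF ribaucour_vec_has_derivative[OF u], symmetric] by simp
  moreover have "conn_form X N E k k u v = 0" for k v
    using conn_form_skew[OF u, of k k v] by simp
  moreover have "conn_form X N E 2 1 u v = - conn_form X N E 1 2 u v" for v
    by (rule conn_form_skew[OF u])
  ultimately have "dif Z u (E i u) = (dif (Omi i) u (E i u)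
      + (\<Sum>k\<in>UNIV. Omi k u * conn_form X N E k i u (E i u)) - W u * lam i u) *\<^sub>R frame X E i u"
    using exhaust_2[of i] dif_Omi[OF u, of 1 2] dif_Omi[OF u, of 2 1]
    by (auto simp: sum_2 dif_frame[OF u] dif_normal_frame[OF u] dif_W[OF u] algebra_simps)
  then show ?thesis by (simp add: ribaucour_T_def)
qed

lemma ribaucour_param_derivative:
  assumes u: "u \<in> U"
  shows "dif (ribaucour_param X N E Om Omi W) u (E i u)
    = (1 - Om u * T i u / S u) *\<^sub>R mirror (Z u) (frame X E i u)"
proof -
  let ?Y = "\<lambda>x. X x - (2 * Om x / (Z x \<bullet> Z x)) *\<^sub>R Z x"
  have Z: "(Z has_derivative dif Z u) (at u)"
    using ribaucour_vec_has_derivative[OF u] differentiableI frechet_derivative_works by blast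
  have Om: "(Om has_derivative dif Om u) (at u)"
    using data u by (intro dif_has_derivative) (auto simp: ribaucour_data_def)
  have nz: "Z u \<noteq> 0"
    using ribaucour_S_pos[OF u] ribaucour_vec_inner_self[OF u] by auto
  have "dif ?Y u (E i u) = (1 - 2 * Om u * (T i u / 2) / (Z u \<bullet> Z u)) *\<^sub>R
      mirror (Z u) (dif X u (E i u))"
    by (rule derivative_of_mirrored_point[OF dif_has_derivative[OF smooth_X u] Z Om nz])
      (use u in \<open>simp_all add: dif_Om ribaucour_vec_derivative frame_def[of X, symmetric]
        ribaucour_vec_inner_frame\<close>)
  then have Y: "dif ?Y u (E i u)
      = (1 - Om u * T i u / S u) *\<^sub>R mirror (Z u) (frame X E i u)"
    by (simp add: ribaucour_vec_inner_self[OF u] frame_def)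
  have "?Y x = ribaucour_param X N E Om Omi W x" if "x \<in> U" for x
    using ribaucour_vec_inner_self[OF that] by (simp add: ribaucour_param_def ribaucour_vec_def)
  moreover have "?Y differentiable (at u)"
    using nz by (intro differentiable_diff differentiable_scaleR differentiable_divide
        differentiable_inner differentiable_mult differentiable_const)
      (use Z Om smooth_on_imp_differentiable[OF smooth_X u] in \<open>auto simp: differentiable_def\<close>)
  ultimately have "dif ?Y u = dif (ribaucour_param X N E Om Omi W) u"
    using open_U u by (intro frechet_derivative_transform_within_open)
  then show ?thesis using Y by simp
qed

lemma ribaucour_conformal:
  assumes u: "u \<in> U"
    and diff: "ribaucour_param X N E Om Omi W differentiable (at u)"
    and \<mu>: "\<And>i. (1 - Om u * T i u / S u)\<^sup>2 = \<mu>"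
  shows "dif (ribaucour_param X N E Om Omi W) u v \<bullet> dif (ribaucour_param X N E Om Omi W) u w
    = \<mu> * (dif X u v \<bullet> dif X u w)"
proof -
  let ?Y = "ribaucour_param X N E Om Omi W"
  define c where "c = (\<lambda>i. 1 - Om u * T i u / S u)"
  have linX: "linear (dif X u)"
    using dif_has_derivative[OF smooth_X u] has_derivative_linear by blast
  have linY: "linear (dif ?Y u)"
    using diff by (rule linear_frechet_derivative)
  have nz: "Z u \<noteq> 0"
    using ribaucour_S_pos[OF u] ribaucour_vec_inner_self[OF u] by auto
  have EX: "dif X u v = (\<Sum>i\<in>UNIV. coframe X E i u v *\<^sub>R frame X E i u)" for v
    by (subst tangent_expansion[OF u, of v])
      (simp add: linear_sum[OF linX] linear_cmul[OF linX] frame_def)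
  have EY: "dif ?Y u v
      = (\<Sum>i\<in>UNIV. coframe X E i u v *\<^sub>R c i *\<^sub>R mirror (Z u) (frame X E i u))" for v
    by (subst tangent_expansion[OF u, of v])
      (simp add: linear_sum[OF linY] linear_cmul[OF linY] ribaucour_param_derivative[OF u] c_def)
  have c2: "c i * c i = \<mu>" for i
    using \<mu>[of i] by (simp add: c_def power2_eq_square)
  have "dif ?Y u v \<bullet> dif ?Y u w
      = (\<Sum>i\<in>UNIV. coframe X E i u v * coframe X E i u w * (c i * c i))"
    by (simp add: EY sum_2 inner_add_left inner_add_right mirror_inner[OF nz] frame_inner[OF u])
  also have "\<dots> = \<mu> * (\<Sum>i\<in>UNIV. coframe X E i u v * coframe X E i u w)"
    by (simp add: c2 sum_distrib_left mult.commute)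
  also have "(\<Sum>i\<in>UNIV. coframe X E i u v * coframe X E i u w) = dif X u v \<bullet> dif X u w"
    by (simp add: EX[of v] EX[of w] sum_2 inner_add_left inner_add_right frame_inner[OF u])
  finally show ?thesis .
qed

end

section \<open>Isothermic surfaces and conformal maps\<close>

lemma isothermic_wrt_conformal:
  assumes "smooth_on X U" "smooth_on Y U"
    and conf: "\<And>u. u \<in> U \<Longrightarrow> \<exists>\<mu>\<noteq>0. \<forall>v w. dif Y u v \<bullet> dif Y u w = \<mu> * (dif X u v \<bullet> dif X u w)"
  shows "isothermic_wrt P Y U \<longleftrightarrow> isothermic_wrt P X U"
proof -
  have fff_eq: "fff (Y \<circ> \<phi>) 1 2 x = 0 \<longleftrightarrow> fff (X \<circ> \<phi>) 1 2 x = 0"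
      "fff (Y \<circ> \<phi>) 1 1 x = fff (Y \<circ> \<phi>) 2 2 x \<longleftrightarrow> fff (X \<circ> \<phi>) 1 1 x = fff (X \<circ> \<phi>) 2 2 x"
    if "diffeo_between \<phi> D V" "V \<subseteq> U" "x \<in> D" for \<phi> D V x
  proof -
    have \<phi>: "\<phi> differentiable (at x)"
      using that smooth_on_imp_differentiable unfolding diffeo_between_def by blast
    have "\<phi> x \<in> U"
      using that unfolding diffeo_between_def homeomorphism_def by blast
    then have XY: "X differentiable (at (\<phi> x))" "Y differentiable (at (\<phi> x))"
      using smooth_on_imp_differentiable assms(1,2) by blast+
    obtain \<mu> where "\<mu> \<noteq> 0"
      and \<mu>: "\<And>v w. dif Y (\<phi> x) v \<bullet> dif Y (\<phi> x) w = \<mu> * (dif X (\<phi> x) v \<bullet> dif X (\<phi> x) w)"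
      using conf[OF \<open>\<phi> x \<in> U\<close>] by blast
    have "fff (Y \<circ> \<phi>) i j x = \<mu> * fff (X \<circ> \<phi>) i j x" for i j
      by (simp add: fff_def frechet_derivative_compose[OF \<phi> XY(1)]
          frechet_derivative_compose[OF \<phi> XY(2)] \<mu>)
    then show "fff (Y \<circ> \<phi>) 1 2 x = 0 \<longleftrightarrow> fff (X \<circ> \<phi>) 1 2 x = 0"
      "fff (Y \<circ> \<phi>) 1 1 x = fff (Y \<circ> \<phi>) 2 2 x \<longleftrightarrow> fff (X \<circ> \<phi>) 1 1 x = fff (X \<circ> \<phi>) 2 2 x"
      using \<open>\<mu> \<noteq> 0\<close> by simp_all
  qed
  show ?thesis
    unfolding isothermic_wrt_def
    by (intro ball_cong refl ex_cong1 conj_cong) (erule (2) fff_eq)+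
qed

section \<open>Ribaucour transforms of isothermic surfaces\<close>

theorem theorem1p7:
  fixes X N Xt :: "real^2 \<Rightarrow> real^3"
    and U :: "(real^2) set"
    and E :: "2 \<Rightarrow> real^2 \<Rightarrow> real^2"
    and lam Omi :: "2 \<Rightarrow> real^2 \<Rightarrow> real"
    and Om W h :: "real^2 \<Rightarrow> real"
  assumes "surface X U"
    and "unit_normal X U N"
    and "\<And>u. u \<in> U \<Longrightarrow> \<not> umbilic X N u"
    and "principal_frame X U N E lam"
    and "ribaucour_data X U N E lam Om Omi W"
    and "Xt = ribaucour_param X N E Om Omi W"
    and "h = (\<lambda>u. Om u / W u)"
    and "ribaucour_associated X U N h Xt"
    and "\<And>I c. line_of_curvature X N U I c \<Longrightarrow> \<not> (h \<circ> c) constant_on I"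
    and "(\<forall>u\<in>U. ribaucour_T X N E lam Omi W 1 u + ribaucour_T X N E lam Omi W 2 u
                  = 2 * ribaucour_S Omi W u / Om u) \<or>
         (\<forall>u\<in>U. ribaucour_T X N E lam Omi W 1 u - ribaucour_T X N E lam Omi W 2 u = 0)"
  shows "isothermic_wrt (principal_dir X N) Xt U \<longleftrightarrow> isothermic_wrt (principal_dir X N) X U"
proof -
  interpret ribaucour_surface X N U E lam Om W Omi
    by unfold_locales (use assms in auto)
  have surf_Xt: "surface Xt U"
    using assms(8) by (simp add: ribaucour_associated_def)
  have "\<exists>\<mu>\<noteq>0. \<forall>v w. dif Xt u v \<bullet> dif Xt u w = \<mu> * (dif X u v \<bullet> dif X u w)" if u: "u \<in> U" for u
  proof -
    have "S u \<noteq> 0" using ribaucour_S_pos[OF u] by simp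
    have "Om u \<noteq> 0" using data u by (simp add: ribaucour_data_def)
    have "T 1 u + T 2 u = 2 * S u / Om u \<or> T 1 u = T 2 u"
      using assms(10) u by auto
    then have "(1 - Om u * T 2 u / S u)\<^sup>2 = (1 - Om u * T 1 u / S u)\<^sup>2"
    proof
      assume "T 1 u + T 2 u = 2 * S u / Om u"
      then have "Om u * T 2 u = 2 * S u - Om u * T 1 u"
        using \<open>Om u \<noteq> 0\<close> by (simp add: field_simps)
      then have "1 - Om u * T 2 u / S u = - (1 - Om u * T 1 u / S u)"
        using \<open>S u \<noteq> 0\<close> by (simp add: diff_divide_distrib)
      then show ?thesis by (simp only: power2_minus)
    qed simp
    then have \<mu>: "(1 - Om u * T i u / S u)\<^sup>2 = (1 - Om u * T 1 u / S u)\<^sup>2" for i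
      using exhaust_2[of i] by auto
    have diff: "Xt differentiable (at u)"
      using surf_Xt u smooth_on_imp_differentiable unfolding surface_def by blast
    have conf: "dif Xt u v \<bullet> dif Xt u w
        = (1 - Om u * T 1 u / S u)\<^sup>2 * (dif X u v \<bullet> dif X u w)" for v w
      using ribaucour_conformal[OF u _ \<mu>] diff assms(6) by simp
    \<comment> \<open>A vanishing factor would make the differential of the transformed surface zero.\<close>
    have "(1 - Om u * T 1 u / S u)\<^sup>2 \<noteq> 0"
    proof
      assume zero: "(1 - Om u * T 1 u / S u)\<^sup>2 = 0"
      have "dif Xt u v = 0" for v using conf[of v v] unfolding zero by simp
      then have "\<not> inj (dif Xt u)"
        by (metis injD zero_neq_one)
      then show False using surf_Xt u by (simp add: surface_def)
    qed
    then show ?thesis using conf by blast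
  qed
  then show ?thesis
    using surf_Xt smooth_X by (intro isothermic_wrt_conformal) (auto simp: surface_def)
qed

end
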